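(* Let $n\ge 1$ be an integer and let $d=n$. Then the dual of the $(n,d)$ Delsarte linear program has a unique optimum if and only if $n\le 2$.
   Context: $[a,b]=\{x\in\mathbb{Z}: a\le x\le b\}$ and $[a]=\{1,\dots,a\}$. $\binom{a}{b}=0$ unless $0\le b\le a$. For $0\le i,j\le n$, the Krawtchouk polynomial is $K_j(i)=K_j(i;n)=\sum_{k=0}^j(-1)^k\binom{i}{k}\binom{n-i}{j-k}$. For integers $1\le d\le n$, the dual of the $(n,d)$ Delsarte linear program is the following linear program in real variables $c=(c_0,\dots,c_n)$: minimize $\sum_{j=0}^n c_j\binom{n}{j}$ subject to $\sum_{j=0}^n c_jK_j(i)\le 0$ for all $i\in[d,n]$; $c_j\ge 0$ for all $j\in[n]$; $c_0=1$. An optimum is a feasible point achieving the optimal objective value. *)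

theory Defs
  imports Complex_Main "HOL-Library.FuncSet"
begin

text \<open>Only used for \<open>i, j \<le> n\<close>, where both natural-number subtractions are exact.\<close>

definition krawtchouk :: "nat \<Rightarrow> nat \<Rightarrow> nat \<Rightarrow> real" where
  "krawtchouk n j i =
     (\<Sum>k=0..j. (-1) ^ k * real (i choose k) * real ((n - i) choose (j - k)))"

text \<open>A vector \<open>(c\<^sub>0, \<dots>, c\<^sub>n)\<close> is a function in \<open>extensional {0..n}\<close>, i.e. fixed to be
  \<open>undefined\<close> outside \<open>{0..n}\<close>, so that equality of functions is equality of vectors.\<close>

definition delsarte_dual_feasible :: "nat \<Rightarrow> nat \<Rightarrow> (nat \<Rightarrow> real) set" where
  "delsarte_dual_feasible n d =
     {c \<in> extensional {0..n}.
        (\<forall>i\<in>{d..n}. (\<Sum>j=0..n. c j * krawtchouk n j i) \<le> 0) \<and>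
        (\<forall>j\<in>{1..n}. 0 \<le> c j) \<and>
        c 0 = 1}"

definition delsarte_dual_objective :: "nat \<Rightarrow> (nat \<Rightarrow> real) \<Rightarrow> real" where
  "delsarte_dual_objective n c = (\<Sum>j=0..n. c j * real (n choose j))"

definition delsarte_dual_optimum :: "nat \<Rightarrow> nat \<Rightarrow> (nat \<Rightarrow> real) \<Rightarrow> bool" where
  "delsarte_dual_optimum n d c \<longleftrightarrow>
     c \<in> delsarte_dual_feasible n d \<and>
     (\<forall>c'\<in>delsarte_dual_feasible n d.
        delsarte_dual_objective n c \<le> delsarte_dual_objective n c')"

end

theory Submission
  imports Defs
begin

text \<open>
  For \<open>d = n\<close> the only inequality of the program besides nonnegativity is the one at \<open>i = n\<close>,
  and there \<open>K\<^sub>j(n) = (-1)\<^sup>j (n choose j)\<close>. Hence the inequality says that the even-indexed part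
  of the objective is at most its odd-indexed part. Since the even part contains
  \<open>c\<^sub>0 = 1\<close>, the objective is at least 2, with equality exactly when
  both parts equal 1; in particular \<open>c\<^sub>j = 0\<close> for every positive even \<open>j\<close>
  (\<open>objective_lower_bound\<close>).

  The odd part may be concentrated on any single odd index \<open>m \<le> n\<close>, and each choice gives an
  optimum (\<open>two_point_optimum\<close>). If \<open>n \<ge> 3\<close>, the indices 1 and 3 give different
  optima. If \<open>n \<le> 2\<close>, the only odd index is 1, so the value 2 of the objective determines
  \<open>c\<^sub>1\<close>, and the optimum is unique.
\<close>

lemma krawtchouk_at_n: "krawtchouk n j n = (-1) ^ j * real (n choose j)"
proof -
  have "krawtchouk n j n = (\<Sum>k=0..j. if k = j then (-1) ^ j * real (n choose j) else 0)"
    unfolding krawtchouk_def by (rule sum.cong) auto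
  then show ?thesis by simp
qed

lemma feasible_iff:
  "c \<in> delsarte_dual_feasible n n \<longleftrightarrow>
     c \<in> extensional {0..n} \<and> (\<Sum>j=0..n. c j * ((-1) ^ j * real (n choose j))) \<le> 0 \<and>
     (\<forall>j\<in>{1..n}. 0 \<le> c j) \<and> c 0 = 1"
  by (simp add: delsarte_dual_feasible_def krawtchouk_at_n)

text \<open>
  Adding the nonpositive sum at \<open>i = n\<close> to the objective cancels the odd terms and doubles the
  even ones. What remains is a sum of nonnegative terms, of which those at \<open>0\<close> and at \<open>k\<close>
  are kept. The case \<open>k = 0\<close> gives the bound 2.
\<close>

lemma objective_lower_bound:
  assumes feas: "c \<in> delsarte_dual_feasible n n" and k: "even k" "k \<le> n"
  shows "2 + (if k = 0 then 0 else 2 * c k * real (n choose k)) \<le> delsarte_dual_objective n c"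
proof -
  let ?g = "\<lambda>j. c j * (1 + (-1) ^ j) * real (n choose j)"
  have c0: "c 0 = 1" and nonneg: "\<And>j. j \<in> {1..n} \<Longrightarrow> 0 \<le> c j"
    and le: "(\<Sum>j=0..n. c j * ((-1) ^ j * real (n choose j))) \<le> 0"
    using feas by (auto simp: feasible_iff)
  have g_nonneg: "0 \<le> ?g j" if "j \<in> {0..n}" for j
  proof -
    have "0 \<le> c j" using that c0 nonneg[of j] by (cases "j = 0") auto
    moreover have "0 \<le> 1 + (-1 :: real) ^ j" by (cases "even j") auto
    ultimately show ?thesis by simp
  qed
  have "2 + (if k = 0 then 0 else 2 * c k * real (n choose k)) = sum ?g {0, k}"
    using k c0 by (cases "k = 0") auto
  also have "\<dots> \<le> sum ?g {0..n}"
    using k g_nonneg by (intro sum_mono2) auto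
  also have "\<dots> = delsarte_dual_objective n c
      + (\<Sum>j=0..n. c j * ((-1) ^ j * real (n choose j)))"
    by (simp add: delsarte_dual_objective_def sum.distrib[symmetric] algebra_simps)
  finally show ?thesis using le by linarith
qed

text \<open>The value at \<open>m\<close> makes the term of index \<open>m\<close> in the objective equal to the term 1 of
  index 0, so that for odd \<open>m\<close> the inequality at \<open>i = n\<close> is tight.\<close>

definition two_point :: "nat \<Rightarrow> nat \<Rightarrow> nat \<Rightarrow> real" where
  "two_point n m =
     (\<lambda>j\<in>{0..n}. if j = 0 then 1 else if j = m then 1 / real (n choose m) else 0)"

lemma two_point_sum:
  assumes "odd m" "m \<le> n"
  shows "(\<Sum>j=0..n. two_point n m j * (s j * real (n choose j))) = s 0 + s m"
proof -
  have "(\<Sum>j=0..n. two_point n m j * (s j * real (n choose j)))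
      = (\<Sum>j\<in>{0, m}. two_point n m j * (s j * real (n choose j)))"
    using assms by (intro sum.mono_neutral_right) (auto simp: two_point_def)
  also have "\<dots> = s 0 + s m"
    using assms by (auto simp: two_point_def elim!: oddE)
  finally show ?thesis .
qed

lemma two_point_objective:
  assumes "odd m" "m \<le> n"
  shows "delsarte_dual_objective n (two_point n m) = 2"
  using two_point_sum[OF assms, of "\<lambda>_. 1"] by (simp add: delsarte_dual_objective_def)

lemma two_point_feasible:
  assumes "odd m" "m \<le> n"
  shows "two_point n m \<in> delsarte_dual_feasible n n"
  using two_point_sum[OF assms, of "\<lambda>j. (-1) ^ j"] assms
  by (auto simp: feasible_iff two_point_def)

lemma two_point_optimum:
  assumes "odd m" "m \<le> n"
  shows "delsarte_dual_optimum n n (two_point n m)"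
  using objective_lower_bound[of _ n 0] two_point_feasible[OF assms] two_point_objective[OF assms]
  by (auto simp: delsarte_dual_optimum_def)

lemma optimum_objective:
  assumes "delsarte_dual_optimum n n c" "1 \<le> n"
  shows "delsarte_dual_objective n c = 2"
proof (rule antisym)
  show "delsarte_dual_objective n c \<le> 2"
    using assms two_point_feasible[of 1 n] two_point_objective[of 1 n]
    by (force simp: delsarte_dual_optimum_def)
  show "2 \<le> delsarte_dual_objective n c"
    using assms objective_lower_bound[of c n 0] by (simp add: delsarte_dual_optimum_def)
qed

lemma optimum_even_zero:
  assumes opt: "delsarte_dual_optimum n n c" and k: "even k" "1 \<le> k" "k \<le> n"
  shows "c k = 0"
proof -
  have feas: "c \<in> delsarte_dual_feasible n n"
    using opt by (simp add: delsarte_dual_optimum_def)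
  have "c k * real (n choose k) \<le> 0"
    using objective_lower_bound[OF feas] k optimum_objective[OF opt] by force
  moreover have "0 < real (n choose k)" using k by simp
  ultimately have "c k \<le> 0" by (simp add: mult_le_0_iff)
  moreover have "0 \<le> c k" using feas k by (simp add: feasible_iff)
  ultimately show ?thesis by simp
qed

lemma optimum_unique_small:
  assumes opt: "delsarte_dual_optimum n n c" and n: "1 \<le> n" "n \<le> 2"
  shows "c = two_point n 1"
proof (rule extensionalityI)
  have feas: "c \<in> delsarte_dual_feasible n n"
    using opt by (simp add: delsarte_dual_optimum_def)
  show "c \<in> extensional {0..n}" using feas by (simp add: feasible_iff)
  show "two_point n 1 \<in> extensional {0..n}" by (simp add: two_point_def)
  have c0: "c 0 = 1" using feas by (simp add: feasible_iff)
  have "n = 1 \<or> n = 2" using n by auto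
  then have c1: "c 1 = 1 / real n"
    using optimum_objective[OF opt n(1)] optimum_even_zero[OF opt, of 2] c0
    by (auto simp: delsarte_dual_objective_def numeral_2_eq_2)
  fix j assume j: "j \<in> {0..n}"
  then consider "j = 0" | "j = 1" | "j = 2" using n by force
  then show "c j = two_point n 1 j"
    using j c0 c1 optimum_even_zero[OF opt, of 2] by cases (auto simp: two_point_def)
qed

theorem proposition3p4:
  fixes n d :: nat
  assumes "1 \<le> n" and "d = n"
  shows "(\<exists>!c. delsarte_dual_optimum n d c) \<longleftrightarrow> n \<le> 2"
proof
  assume uniq: "\<exists>!c. delsarte_dual_optimum n d c"
  show "n \<le> 2"
  proof (rule ccontr)
    assume "\<not> n \<le> 2"
    then have n: "3 \<le> n" by simp
    then have "two_point n 1 = two_point n 3"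
      using uniq two_point_optimum[of 1 n] two_point_optimum[of 3 n] \<open>d = n\<close> by auto
    then have "two_point n 1 1 = two_point n 3 1" by simp
    then show False using n by (simp add: two_point_def)
  qed
next
  assume "n \<le> 2"
  then show "\<exists>!c. delsarte_dual_optimum n d c"
    using assms two_point_optimum[of 1 n] optimum_unique_small by auto
qed

end
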